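(* The conflict-free closed neighborhood (CF-CN) coloring problem is polynomial time solvable on the class of split graphs: there is a polynomial-time algorithm that, given a finite simple connected undirected split graph $G$ and an integer $k$, decides whether $G$ has a CF-CN coloring $V(G)\to\{1,\dots,k\}$.
   Context: A split graph is a graph whose vertex set can be partitioned into a clique and an independent set. Let $N[v]$ be the closed neighborhood of $v$. For a coloring $C_G:V(G)\to\{1,\dots,k\}$ (not necessarily proper), a set $U\subseteq V(G)$ has a unique color if there is a color $c$ with $|\{u\in U: C_G(u)=c\}|=1$. The coloring is a conflict-free closed neighborhood (CF-CN) coloring if $N[v]$ has a unique color for every $v\in V(G)$. *)

theory Defs
  imports "Graph_Theory.Graph_Theory" "HOL-Computational_Algebra.Polynomial"
begin

section \<open>Split graphs and conflict-free closed neighborhood colorings\<close>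

text \<open>
  As in the library, finite simple undirected graphs are finite symmetric loop-free digraphs
  (locale \<^locale>\<open>pair_graph\<close>): an edge is a pair of opposite arcs.
\<close>

definition clique :: "'a pair_pre_digraph \<Rightarrow> 'a set \<Rightarrow> bool" where
  "clique G K \<longleftrightarrow> K \<subseteq> pverts G \<and> (\<forall>u\<in>K. \<forall>v\<in>K. u \<noteq> v \<longrightarrow> (u, v) \<in> parcs G)"

definition independent_set :: "'a pair_pre_digraph \<Rightarrow> 'a set \<Rightarrow> bool" where
  "independent_set G I \<longleftrightarrow> I \<subseteq> pverts G \<and> (\<forall>u\<in>I. \<forall>v\<in>I. (u, v) \<notin> parcs G)"

text \<open>Either part of the partition may be empty.\<close>

definition split_graph :: "'a pair_pre_digraph \<Rightarrow> bool" where
  "split_graph G \<longleftrightarrow>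
     (\<exists>K I. K \<union> I = pverts G \<and> K \<inter> I = {} \<and> clique G K \<and> independent_set G I)"

definition closed_nbhd :: "'a pair_pre_digraph \<Rightarrow> 'a \<Rightarrow> 'a set" where
  "closed_nbhd G v = insert v {u. (v, u) \<in> parcs G}"

definition has_unique_color :: "('a \<Rightarrow> 'c) \<Rightarrow> 'a set \<Rightarrow> bool" where
  "has_unique_color C U \<longleftrightarrow> (\<exists>c. card {u \<in> U. C u = c} = 1)"

definition cfcn_coloring :: "'a pair_pre_digraph \<Rightarrow> int \<Rightarrow> ('a \<Rightarrow> int) \<Rightarrow> bool" where
  "cfcn_coloring G k C \<longleftrightarrow>
     (\<forall>v\<in>pverts G. C v \<in> {1..k}) \<and> (\<forall>v\<in>pverts G. has_unique_color C (closed_nbhd G v))"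


section \<open>Polynomial-time decidability\<close>

text \<open>
  The machine model is a random access machine with structured control flow. A program uses
  finitely many registers, each holding a natural number, and a memory that is addressed
  indirectly through registers. Every instruction and every test costs one unit. The
  arithmetic is restricted to addition and truncated subtraction, so the bit length of the
  numbers grows by at most one per step and time is polynomially related to Turing machine
  time (Cook and Reckhow, 1973); unit-cost multiplication would break this.
\<close>

datatype com =
    Const nat nat          \<comment> \<open>register, constant\<close>
  | Add nat nat nat        \<comment> \<open>target, two operands\<close>
  | Sub nat nat nat
  | Load nat nat           \<comment> \<open>target, register holding the address\<close>
  | Store nat nat          \<comment> \<open>register holding the address, source\<close>
  | Seq com com
  | Cond nat com com       \<comment> \<open>tests whether the register is nonzero\<close>
  | While nat com

type_synonym state = "(nat \<Rightarrow> nat) \<times> (nat \<Rightarrow> nat)"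

text \<open>
  \<open>exec c s t s'\<close>: program \<open>c\<close>, started in state \<open>s = (registers, memory)\<close>, halts after
  \<open>t\<close> steps in state \<open>s'\<close>.
\<close>

inductive exec :: "com \<Rightarrow> state \<Rightarrow> nat \<Rightarrow> state \<Rightarrow> bool" where
  Const: "exec (Const r n) (R, M) 1 (R(r := n), M)"
| Add: "exec (Add r a b) (R, M) 1 (R(r := R a + R b), M)"
| Sub: "exec (Sub r a b) (R, M) 1 (R(r := R a - R b), M)"
| Load: "exec (Load r a) (R, M) 1 (R(r := M (R a)), M)"
| Store: "exec (Store a r) (R, M) 1 (R, M(R a := R r))"
| Seq: "exec c1 s1 t1 s2 \<Longrightarrow> exec c2 s2 t2 s3 \<Longrightarrow> exec (Seq c1 c2) s1 (t1 + t2) s3"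
| CondTrue: "R r \<noteq> 0 \<Longrightarrow> exec c1 (R, M) t s \<Longrightarrow> exec (Cond r c1 c2) (R, M) (1 + t) s"
| CondFalse: "R r = 0 \<Longrightarrow> exec c2 (R, M) t s \<Longrightarrow> exec (Cond r c1 c2) (R, M) (1 + t) s"
| WhileFalse: "R r = 0 \<Longrightarrow> exec (While r c) (R, M) 1 (R, M)"
| WhileTrue: "R r \<noteq> 0 \<Longrightarrow> exec c (R, M) t1 s2 \<Longrightarrow> exec (While r c) s2 t2 s3 \<Longrightarrow>
    exec (While r c) (R, M) (1 + t1 + t2) s3"

inductive_cases exec_elims:
  "exec (Const r n) s t s'" "exec (Add r a b) s t s'" "exec (Sub r a b) s t s'"
  "exec (Load r a) s t s'" "exec (Store a r) s t s'" "exec (Seq c1 c2) s t s'"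
  "exec (Cond r c1 c2) s t s'" "exec (While r c) s t s'"

lemma exec_deterministic:
  "exec c s t s' \<Longrightarrow> exec c s u s'' \<Longrightarrow> u = t \<and> s'' = s'"
proof (induction arbitrary: u s'' rule: exec.induct)
  case Const
  then show ?case by (rule exec_elims(1)) simp
next
  case Add
  then show ?case by (rule exec_elims(2)) simp
next
  case Sub
  then show ?case by (rule exec_elims(3)) simp
next
  case Load
  then show ?case by (rule exec_elims(4)) simp
next
  case Store
  then show ?case by (rule exec_elims(5)) simp
next
  case (Seq c1 s1 t1 s2 c2 t2 s3)
  from Seq.prems obtain v1 s2' v2 where
    *: "u = v1 + v2" "exec c1 s1 v1 s2'" "exec c2 s2' v2 s''"
    by (rule exec_elims(6))
  have "v1 = t1 \<and> s2' = s2" by (rule Seq.IH(1)[OF *(2)])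
  moreover from this *(3) have "v2 = t2 \<and> s'' = s3" by (intro Seq.IH(2)) simp
  ultimately show ?case using *(1) by simp
next
  case (CondTrue R r c1 M t s c2)
  from CondTrue.prems obtain v where "u = Suc v" "exec c1 (R, M) v s''"
    by (rule exec_elims(7)) (use CondTrue.hyps in simp_all)
  with CondTrue.IH[of v s''] show ?case by simp
next
  case (CondFalse R r c2 M t s c1)
  from CondFalse.prems obtain v where "u = Suc v" "exec c2 (R, M) v s''"
    by (rule exec_elims(7)) (use CondFalse.hyps in simp_all)
  with CondFalse.IH[of v s''] show ?case by simp
next
  case (WhileFalse R r c M)
  from WhileFalse.prems show ?case
    by (rule exec_elims(8)) (use WhileFalse.hyps in simp_all)
next
  case (WhileTrue R r c M t1 s2 t2 s3)
  from WhileTrue.prems obtain v1 s2' v2 where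
    *: "u = Suc (v1 + v2)" "exec c (R, M) v1 s2'" "exec (While r c) s2' v2 s''"
    by (rule exec_elims(8)) (use WhileTrue.hyps in simp_all)
  have "v1 = t1 \<and> s2' = s2" by (rule WhileTrue.IH(1)[OF *(2)])
  moreover from this *(3) have "v2 = t2 \<and> s'' = s3" by (intro WhileTrue.IH(2)) simp
  ultimately show ?case using *(1) by simp
qed

text \<open>
  The input string is placed in memory, one bit per cell starting at address 0, and its
  length in register 0; all other registers and cells are 0.
\<close>

definition input_state :: "bool list \<Rightarrow> state" where
  "input_state w =
     ((\<lambda>_. 0)(0 := length w), (\<lambda>i. if i < length w \<and> w ! i then 1 else 0))"

text \<open>
  The decision problem \<open>P\<close> on the class \<open>D\<close> of instances, encoded as bit strings by \<open>enc\<close>.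
  The answer is read off register 0, and the running time is bounded by a polynomial in the
  length of the encoding. As usual for a problem restricted to a class of instances, nothing
  is required of the program on strings that do not encode an instance in \<open>D\<close>.
\<close>

definition poly_time_decidable_on ::
  "('i \<Rightarrow> bool list) \<Rightarrow> 'i set \<Rightarrow> ('i \<Rightarrow> bool) \<Rightarrow> bool" where
  "poly_time_decidable_on enc D P \<longleftrightarrow>
     (\<exists>(c :: com) (p :: nat poly). \<forall>x\<in>D. \<exists>t R M.
        exec c (input_state (enc x)) t (R, M) \<and>
        t \<le> poly p (length (enc x)) \<and>
        R 0 = (if P x then 1 else 0))"


section \<open>Encoding of instances\<close>

text \<open>Binary representation, least significant bit first, without leading zeros.\<close>

fun nat_bits :: "nat \<Rightarrow> bool list" where
  "nat_bits n = (if n = 0 then [] else odd n # nat_bits (n div 2))"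

declare nat_bits.simps [simp del]

definition int_bits :: "int \<Rightarrow> bool list" where
  "int_bits k = (k < 0) # nat_bits (nat \<bar>k\<bar>)"

definition adjacency_bits :: "'a list \<Rightarrow> 'a pair_pre_digraph \<Rightarrow> bool list" where
  "adjacency_bits vs G = concat (map (\<lambda>u. map (\<lambda>v. (u, v) \<in> parcs G) vs) vs)"

text \<open>
  An instance \<open>(vs, G, k)\<close> consists of a graph \<open>G\<close>, an enumeration \<open>vs\<close> of its vertices and
  an integer \<open>k\<close>. It is encoded by the number of vertices in unary, terminated by a 0, the
  adjacency matrix by rows, and finally the sign bit and the binary digits of \<open>k\<close>.
  In particular no partition into a clique and an independent set is part of the input.
\<close>

fun encode :: "'a list \<times> 'a pair_pre_digraph \<times> int \<Rightarrow> bool list" where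
  "encode (vs, G, k) =
     replicate (length vs) True @ [False] @ adjacency_bits vs G @ int_bits k"

text \<open>
  Vertices are natural numbers; every finite graph is isomorphic to such a graph, and the
  encoding does not depend on the names of the vertices.
\<close>

definition connected_split_instances :: "(nat list \<times> nat pair_pre_digraph \<times> int) set" where
  "connected_split_instances =
     {(vs, G, k). pair_graph G \<and> Digraph_Component.connected (with_proj G) \<and> split_graph G \<and>
        distinct vs \<and> set vs = pverts G}"

end

theory Submission
  imports Defs
begin

text \<open>
  Let \<open>K\<close>, \<open>I\<close> partition a connected split graph with \<open>n \<ge> 2\<close> vertices. One color never suffices,
  and three always do: give one vertex of \<open>K\<close> color 1, the rest of \<open>K\<close> color 2 and \<open>I\<close> color 3.
  If two colors suffice and some color occurs twice in \<open>K\<close>, then the neighborhood of every vertex of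
  \<open>K\<close> contains exactly one vertex of the other color. Either this vertex lies in \<open>K\<close>, and then it
  is universal, or every vertex of \<open>K\<close> has exactly one neighbor in \<open>I\<close>. Otherwise \<open>K\<close> has at most
  two vertices, and without a universal vertex the graph is a double star. Each of these three
  structures admits a 2-coloring. All three can be recognized from the degree sequence without
  knowing the partition: the maximum degree is \<open>n - 1\<close>; it is equal to the number of vertices that
  attain it; the degrees sum to \<open>2 (n - 1)\<close>. A program computes these numbers in a single pass over
  the adjacency matrix.
\<close>

section \<open>Colorings of split graphs\<close>

definition nbrs :: "'a pair_pre_digraph \<Rightarrow> 'a \<Rightarrow> 'a set" where
  "nbrs G v = {u. (v, u) \<in> parcs G}"

definition deg :: "'a pair_pre_digraph \<Rightarrow> 'a \<Rightarrow> nat" where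
  "deg G v = card (nbrs G v)"

definition universal :: "'a pair_pre_digraph \<Rightarrow> 'a \<Rightarrow> bool" where
  "universal G v \<longleftrightarrow> v \<in> pverts G \<and> (\<forall>u\<in>pverts G. u \<noteq> v \<longrightarrow> (v, u) \<in> parcs G)"

definition max_deg :: "'a pair_pre_digraph \<Rightarrow> nat" where
  "max_deg G = Max (deg G ` pverts G)"

lemma has_unique_color_iff:
  "has_unique_color C U \<longleftrightarrow> (\<exists>x\<in>U. \<forall>y\<in>U. C y = C x \<longrightarrow> y = x)"
proof
  assume "has_unique_color C U"
  then obtain c x where "{u \<in> U. C u = c} = {x}"
    unfolding has_unique_color_def by (auto simp: card_1_singleton_iff)
  then have "u \<in> U \<and> C u = c \<longleftrightarrow> u = x" for u unfolding set_eq_iff by simp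
  then show "\<exists>x\<in>U. \<forall>y\<in>U. C y = C x \<longrightarrow> y = x" by metis
next
  assume "\<exists>x\<in>U. \<forall>y\<in>U. C y = C x \<longrightarrow> y = x"
  then obtain x where "x \<in> U" "\<forall>y\<in>U. C y = C x \<longrightarrow> y = x" by blast
  then have "{u \<in> U. C u = C x} = {x}" by auto
  then have "card {u \<in> U. C u = C x} = 1" by simp
  then show "has_unique_color C U" unfolding has_unique_color_def by blast
qed

lemma closed_nbhd_eq: "closed_nbhd G v = insert v (nbrs G v)"
  by (simp add: closed_nbhd_def nbrs_def)

lemma unique_color_self:
  assumes "\<And>y. y \<in> nbrs G v \<Longrightarrow> C y \<noteq> C v"
  shows "has_unique_color C (closed_nbhd G v)"
  unfolding has_unique_color_iff closed_nbhd_eq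
proof (intro bexI[of _ v] ballI impI)
  fix y assume "y \<in> insert v (nbrs G v)" "C y = C v"
  then show "y = v" using assms[of y] by auto
qed simp

text \<open>Connectedness enters as the absence of isolated vertices. This fails for the one-vertex
  graph, which is treated separately.\<close>

locale partitioned_split_graph = pair_graph G for G :: "'a pair_pre_digraph" +
  fixes K I :: "'a set"
  assumes partition: "K \<union> I = pverts G" "K \<inter> I = {}"
    and clique_K: "clique G K"
    and independent_I: "independent_set G I"
    and nonempty: "pverts G \<noteq> {}"
    and no_isolated: "v \<in> pverts G \<Longrightarrow> nbrs G v \<noteq> {}"
begin

lemma finite_parts [simp]: "finite K" "finite I" "finite (pverts G)"
  using partition pair_finite_verts by (auto intro: finite_subset)

lemma part_cases: "v \<in> pverts G \<longleftrightarrow> v \<in> K \<or> v \<in> I"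
  using partition by auto

lemma adj_sym: "(u, v) \<in> parcs G \<Longrightarrow> (v, u) \<in> parcs G"
  using pair_sym_arcs by (auto simp: symmetric_def sym_def)

lemma adj_irrefl: "(v, v) \<notin> parcs G"
  using pair_no_loops[of "(v, v)"] by auto

lemma adj_K: "u \<in> K \<Longrightarrow> v \<in> K \<Longrightarrow> u \<noteq> v \<Longrightarrow> (u, v) \<in> parcs G"
  using clique_K by (auto simp: clique_def)

lemma adj_I: "w \<in> I \<Longrightarrow> (w, u) \<in> parcs G \<Longrightarrow> u \<in> K"
  using independent_I partition in_arcsD2[of w u] by (auto simp: independent_set_def)

lemma nbrs_I: "w \<in> I \<Longrightarrow> nbrs G w \<subseteq> K"
  using adj_I by (auto simp: nbrs_def)

lemma nbr_of_I: "w \<in> I \<Longrightarrow> \<exists>v\<in>K. (w, v) \<in> parcs G"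
  using no_isolated[of w] adj_I part_cases by (fastforce simp: nbrs_def)

lemma nbrs_verts: "nbrs G v \<subseteq> pverts G - {v}"
  using adj_irrefl in_arcsD2 by (auto simp: nbrs_def)

lemma finite_nbrs [simp]: "finite (nbrs G v)"
  by (rule finite_subset[OF nbrs_verts]) simp

lemma K_nonempty: "K \<noteq> {}"
  using nonempty part_cases nbr_of_I by blast

section \<open>Degrees and the three structures\<close>

lemma deg_K:
  assumes "v \<in> K"
  shows "deg G v = card K - 1 + card (nbrs G v \<inter> I)"
proof -
  have "nbrs G v = (K - {v}) \<union> (nbrs G v \<inter> I)"
    using assms adj_K by (auto simp: nbrs_def adj_irrefl part_cases dest: in_arcsD2)
  moreover have "(K - {v}) \<inter> (nbrs G v \<inter> I) = {}" using partition by auto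
  ultimately have "card (nbrs G v) = card (K - {v}) + card (nbrs G v \<inter> I)"
    by (metis card_Un_disjoint finite_Diff finite_Int finite_nbrs finite_parts(1))
  with assms show ?thesis by (simp add: deg_def)
qed

lemma deg_I: "w \<in> I \<Longrightarrow> deg G w \<le> card K"
  unfolding deg_def by (intro card_mono nbrs_I) auto

lemma deg_pos: "v \<in> pverts G \<Longrightarrow> deg G v \<ge> 1"
  using no_isolated[of v] by (simp add: deg_def Suc_le_eq card_gt_0_iff)

lemma nbrs_eq_K: "w \<in> I \<Longrightarrow> deg G w = card K \<Longrightarrow> nbrs G w = K"
  unfolding deg_def by (intro card_subset_eq nbrs_I) auto

lemma deg_le_max: "v \<in> pverts G \<Longrightarrow> deg G v \<le> max_deg G"
  by (simp add: max_deg_def)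

lemma max_deg_eqI:
  assumes "v \<in> pverts G" "deg G v = d" "\<And>u. u \<in> pverts G \<Longrightarrow> deg G u \<le> d"
  shows "max_deg G = d"
  using assms by (auto simp: max_deg_def intro!: Max_eqI)

lemma universal_iff_deg:
  assumes "v \<in> pverts G"
  shows "universal G v \<longleftrightarrow> deg G v = card (pverts G) - 1"
proof -
  have "universal G v \<longleftrightarrow> nbrs G v = pverts G - {v}"
    using assms nbrs_verts[of v] by (auto simp: universal_def nbrs_def)
  also have "\<dots> \<longleftrightarrow> card (nbrs G v) = card (pverts G - {v})"
    using nbrs_verts[of v] by (metis card_subset_eq finite_Diff finite_parts(3))
  also have "\<dots> \<longleftrightarrow> deg G v = card (pverts G) - 1"
    using assms by (simp add: deg_def)
  finally show ?thesis .
qed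

lemma universal_iff_max_deg: "(\<exists>v. universal G v) \<longleftrightarrow> max_deg G = card (pverts G) - 1"
proof
  assume "\<exists>v. universal G v"
  then obtain v where v: "universal G v" "v \<in> pverts G" by (auto simp: universal_def)
  have "deg G u \<le> card (pverts G) - 1" if "u \<in> pverts G" for u
    using card_mono[OF _ nbrs_verts[of u]] that by (simp add: deg_def)
  then show "max_deg G = card (pverts G) - 1"
    using v universal_iff_deg[OF v(2)] by (intro max_deg_eqI) auto
next
  assume *: "max_deg G = card (pverts G) - 1"
  have "max_deg G \<in> deg G ` pverts G"
    using nonempty by (simp add: max_deg_def)
  then obtain v where "v \<in> pverts G" "deg G v = max_deg G" by auto
  with * show "\<exists>v. universal G v" using universal_iff_deg by metis
qed

text \<open>If every vertex of \<open>K\<close> has one neighbor in \<open>I\<close>, all of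
  \<open>K\<close> has degree \<open>card K\<close>, and a vertex of \<open>I\<close> of that degree
  would be universal; so \<open>K\<close> is exactly the set of vertices of maximum degree.
  Conversely, the count rules out a maximum degree above \<open>card K\<close>, since such degrees
  occur only in \<open>K\<close>; equality then forces degree \<open>card K\<close> on all of
  \<open>K\<close>.\<close>

lemma one_nbr_in_I_iff:
  assumes no_univ: "\<nexists>v. universal G v"
  shows "(\<forall>v\<in>K. card (nbrs G v \<inter> I) = 1) \<longleftrightarrow> card {v \<in> pverts G. deg G v = max_deg G} = max_deg G"
proof
  assume one: "\<forall>v\<in>K. card (nbrs G v \<inter> I) = 1"
  have cK: "card K > 0" using K_nonempty by (simp add: card_gt_0_iff)
  have degK: "deg G v = card K" if "v \<in> K" for v
    using that one cK by (simp add: deg_K)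
  have D: "max_deg G = card K"
    using K_nonempty degK deg_I part_cases by (auto intro!: max_deg_eqI)
  have "deg G w \<noteq> card K" if w: "w \<in> I" for w
  proof
    assume "deg G w = card K"
    then have nw: "nbrs G w = K" using w nbrs_eq_K by blast
    have "universal G w"
      unfolding universal_def
    proof (intro conjI ballI impI)
      show "w \<in> pverts G" using w part_cases by blast
      fix u assume u: "u \<in> pverts G" "u \<noteq> w"
      show "(w, u) \<in> parcs G"
      proof (cases "u \<in> K")
        case True
        with nw show ?thesis by (auto simp: nbrs_def)
      next
        case False
        then have "u \<in> I" using u part_cases by blast
        with nbr_of_I obtain v where v: "v \<in> K" "(u, v) \<in> parcs G" by blast
        \<comment> \<open>The single neighbor of \<open>v\<close> in \<open>I\<close> would be both
          \<open>u\<close> and \<open>w\<close>, although these differ.\<close>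
        with one obtain x where "nbrs G v \<inter> I = {x}" by (auto simp: card_1_singleton_iff)
        moreover have "u \<in> nbrs G v \<inter> I" using v \<open>u \<in> I\<close> adj_sym by (simp add: nbrs_def)
        moreover have "w \<in> nbrs G v \<inter> I" using v nw w adj_sym by (auto simp: nbrs_def)
        ultimately show ?thesis using u by auto
      qed
    qed
    with no_univ show False by blast
  qed
  with degK have "{v \<in> pverts G. deg G v = card K} = K"
    using part_cases by auto
  with D show "card {v \<in> pverts G. deg G v = max_deg G} = max_deg G" by simp
next
  assume cnt: "card {v \<in> pverts G. deg G v = max_deg G} = max_deg G"
  \<comment> \<open>A non-neighbor \<open>u\<close> of a clique vertex lies in \<open>I\<close>, and
    its neighbor \<open>b\<close> in \<open>K\<close> has degree at least \<open>card K\<close>.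
    This bounds the maximum degree from below.\<close>
  obtain a where a: "a \<in> K" using K_nonempty by blast
  then have "\<not> universal G a" "a \<in> pverts G" using no_univ part_cases by auto
  then obtain u where u: "u \<in> pverts G" "u \<noteq> a" "(a, u) \<notin> parcs G"
    by (auto simp: universal_def)
  then have "u \<in> I" using a adj_K part_cases by blast
  then obtain b where b: "b \<in> K" "(u, b) \<in> parcs G" using nbr_of_I by blast
  have one_le: "card K \<le> deg G v" if "v \<in> K" "w \<in> I" "(w, v) \<in> parcs G" for v w
  proof -
    have "w \<in> nbrs G v \<inter> I" using that adj_sym by (simp add: nbrs_def)
    then have "card (nbrs G v \<inter> I) > 0" by (auto simp: card_gt_0_iff)
    with deg_K[OF that(1)] show ?thesis by simp
  qed
  have D_ge: "card K \<le> max_deg G"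
    using one_le[OF b(1) \<open>u \<in> I\<close> b(2)] deg_le_max[of b] b part_cases by auto
  have D: "max_deg G = card K"
  proof (rule ccontr)
    assume "max_deg G \<noteq> card K"
    with D_ge have "card K < max_deg G" by simp
    then have "{v \<in> pverts G. deg G v = max_deg G} \<subseteq> K"
      by (auto simp: part_cases dest!: deg_I)
    then have "card {v \<in> pverts G. deg G v = max_deg G} \<le> card K"
      by (intro card_mono) auto
    with cnt \<open>card K < max_deg G\<close> show False by simp
  qed
  have "deg G v = card K" if v: "v \<in> K" for v
  proof (cases "\<exists>w\<in>I. deg G w = card K")
    \<comment> \<open>A vertex of \<open>I\<close> of degree \<open>card K\<close> is adjacent to
      all of \<open>K\<close>, so every vertex of \<open>K\<close> has a neighbor in
      \<open>I\<close>.\<close>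
    case True
    then obtain w where "w \<in> I" "nbrs G w = K" using nbrs_eq_K by blast
    with v have "card K \<le> deg G v" by (intro one_le[of v w]) (auto simp: nbrs_def)
    with deg_le_max[of v] v D part_cases show ?thesis by auto
  next
    case False
    then have "{v \<in> pverts G. deg G v = max_deg G} \<subseteq> K"
      using D part_cases by auto
    then have "{v \<in> pverts G. deg G v = max_deg G} = K"
      using cnt D by (intro card_subset_eq) auto
    with v D show ?thesis by auto
  qed
  moreover have "card K > 0" using K_nonempty by (simp add: card_gt_0_iff)
  ultimately show "\<forall>v\<in>K. card (nbrs G v \<inter> I) = 1"
    using deg_K by fastforce
qed

text \<open>Every vertex of \<open>I\<close> has a neighbor in \<open>K\<close>, which must be the
  single clique vertex.\<close>

lemma universal_if_card_K_le_1:
  assumes "card K \<le> 1"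
  shows "\<exists>v. universal G v"
proof -
  have "card K = 1" using assms K_nonempty by (simp add: card_gt_0_iff le_Suc_eq)
  then obtain a where "K = {a}" by (auto simp: card_1_singleton_iff)
  then have "universal G a"
    unfolding universal_def using part_cases nbr_of_I adj_sym by blast
  then show ?thesis by blast
qed

text \<open>The edges between \<open>K\<close> and \<open>I\<close> are counted once from each side;
  the edges inside the clique contribute the first summand.\<close>

lemma sum_deg:
  "(\<Sum>v\<in>pverts G. deg G v) = card K * (card K - 1) + 2 * (\<Sum>w\<in>I. deg G w)"
proof -
  have "(\<Sum>v\<in>K. card (nbrs G v \<inter> I)) = (\<Sum>v\<in>K. \<Sum>w\<in>I. if (v, w) \<in> parcs G then 1 else 0)"
    by (intro sum.cong refl) (simp add: nbrs_def Int_def conj_commute flip: sum.inter_filter)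
  also have "\<dots> = (\<Sum>w\<in>I. \<Sum>v\<in>K. if (v, w) \<in> parcs G then 1 else 0)"
    by (rule sum.swap)
  also have "\<dots> = (\<Sum>w\<in>I. deg G w)"
  proof (rule sum.cong[OF refl])
    fix w assume "w \<in> I"
    then have "nbrs G w = {v \<in> K. (v, w) \<in> parcs G}"
      using adj_I adj_sym by (auto simp: nbrs_def)
    then show "(\<Sum>v\<in>K. if (v, w) \<in> parcs G then 1 else 0) = deg G w"
      by (simp add: deg_def flip: sum.inter_filter)
  qed
  finally have *: "(\<Sum>v\<in>K. card (nbrs G v \<inter> I)) = (\<Sum>w\<in>I. deg G w)" .
  have "(\<Sum>v\<in>pverts G. deg G v) = (\<Sum>v\<in>K. deg G v) + (\<Sum>w\<in>I. deg G w)"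
    using partition by (simp add: sum.union_disjoint flip: partition(1))
  also have "(\<Sum>v\<in>K. deg G v) = card K * (card K - 1) + (\<Sum>w\<in>I. deg G w)"
    by (simp add: deg_K sum.distrib *)
  finally show ?thesis by simp
qed

text \<open>The right-hand side is the degree sum of a tree. Every vertex of \<open>I\<close> has
  degree at least 1 and, without a universal vertex, \<open>K\<close> has at least two vertices; the
  degree sum reaches this value only when both bounds are tight.\<close>

lemma double_star_iff:
  assumes no_univ: "\<nexists>v. universal G v"
  shows "card K = 2 \<and> (\<forall>w\<in>I. deg G w = 1) \<longleftrightarrow> (\<Sum>v\<in>pverts G. deg G v) = 2 * (card (pverts G) - 1)"
proof -
  have n: "card (pverts G) = card K + card I"
    using partition by (simp add: card_Un_disjoint flip: partition(1))
  \<comment> \<open>Writing \<open>card K\<close> as \<open>q + 2\<close> removes the truncated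
    subtractions from the equation below.\<close>
  obtain q where q: "card K = q + 2"
    using universal_if_card_K_le_1 no_univ by (metis add.commute le_Suc_ex not_less_eq_eq one_add_one plus_1_eq_Suc)
  have ge: "card I \<le> (\<Sum>w\<in>I. deg G w)"
    using sum_mono[of I "\<lambda>_. 1" "deg G"] deg_pos part_cases by auto
  have eq: "(\<Sum>w\<in>I. deg G w) = card I \<longleftrightarrow> (\<forall>w\<in>I. deg G w = 1)"
  proof
    assume "(\<Sum>w\<in>I. deg G w) = card I"
    then have "(\<Sum>w\<in>I. 1) = (\<Sum>w\<in>I. deg G w)" by simp
    then show "\<forall>w\<in>I. deg G w = 1"
      using sum_mono_inv[of "\<lambda>_. 1" I "deg G"] deg_pos part_cases by fastforce
  qed simp
  have "(\<Sum>v\<in>pverts G. deg G v) = 2 * (card (pverts G) - 1) \<longleftrightarrow>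
      q * q + q + 2 * (\<Sum>w\<in>I. deg G w) = 2 * card I"
    by (simp add: sum_deg n q algebra_simps)
  also have "\<dots> \<longleftrightarrow> q = 0 \<and> (\<Sum>w\<in>I. deg G w) = card I"
    using ge by (cases "q = 0") auto
  finally show ?thesis using q eq by auto
qed

section \<open>Colorings from the structures\<close>

lemma coloring_if_universal:
  assumes "universal G v" "k \<ge> 2"
  shows "\<exists>C. cfcn_coloring G k C"
proof (intro exI)
  show "cfcn_coloring G k (\<lambda>u. if u = v then 1 else 2)"
    unfolding cfcn_coloring_def has_unique_color_iff
  proof (intro conjI ballI)
    \<comment> \<open>\<open>v\<close> is the only vertex of color 1 and lies in every closed
      neighborhood.\<close>
    fix u assume "u \<in> pverts G"
    then have "v \<in> closed_nbhd G u"
      using assms(1) adj_sym by (auto simp: universal_def closed_nbhd_def)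
    then show "\<exists>x\<in>closed_nbhd G u. \<forall>y\<in>closed_nbhd G u.
        (if y = v then 1 else 2 :: int) = (if x = v then 1 else 2) \<longrightarrow> y = x" by (intro bexI[of _ v]) auto
  qed (use assms in auto)
qed

lemma coloring_if_3:
  assumes "k \<ge> 3"
  shows "\<exists>C. cfcn_coloring G k C"
proof -
  obtain a where a: "a \<in> K" using K_nonempty by blast
  \<comment> \<open>Vertices of \<open>K\<close> see color 1 exactly once, at \<open>a\<close>; a
    vertex of \<open>I\<close> is the only one of color 3 in its closed neighborhood.\<close>
  define C where "C v = (if v = a then 1 else if v \<in> K then 2 else 3 :: int)" for v
  have "has_unique_color C (closed_nbhd G v)" if v: "v \<in> pverts G" for v
  proof (cases "v \<in> K")
    case True
    then have "a \<in> closed_nbhd G v" using a adj_K by (auto simp: closed_nbhd_def)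
    then show ?thesis unfolding has_unique_color_iff by (intro bexI[of _ a]) (auto simp: C_def)
  next
    case False
    then have "v \<in> I" using v part_cases by blast
    then have "nbrs G v \<subseteq> K" by (rule nbrs_I)
    with False a show ?thesis by (intro unique_color_self) (auto simp: C_def)
  qed
  moreover have "C v \<in> {1..k}" for v using assms by (simp add: C_def)
  ultimately show ?thesis unfolding cfcn_coloring_def by blast
qed

text \<open>Coloring \<open>K\<close> by 1 and \<open>I\<close> by 2 works: a clique vertex sees
  color 2 exactly once, and a vertex of \<open>I\<close> has neighbors only in \<open>K\<close>,
  hence only of the other color.\<close>

lemma coloring_if_one_nbr_in_I:
  assumes one: "\<forall>v\<in>K. card (nbrs G v \<inter> I) = 1"
  shows "\<exists>C. cfcn_coloring G 2 C"
proof -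
  define C where "C v = (if v \<in> K then 1 else 2 :: int)" for v
  have "has_unique_color C (closed_nbhd G v)" if v: "v \<in> pverts G" for v
  proof (cases "v \<in> K")
    case True
    with one obtain x where x: "nbrs G v \<inter> I = {x}" by (auto simp: card_1_singleton_iff)
    then have "x \<notin> K" using partition by auto
    moreover have "y = x" if "y \<in> closed_nbhd G v" "y \<notin> K" for y
    proof -
      have "y \<in> nbrs G v" using that True by (auto simp: closed_nbhd_eq)
      moreover have "y \<in> I" using that calculation nbrs_verts[of v] part_cases by auto
      ultimately show ?thesis using x by auto
    qed
    moreover have "x \<in> closed_nbhd G v" using x by (auto simp: closed_nbhd_eq)
    ultimately show ?thesis unfolding has_unique_color_iff C_def
      by (smt (verit, best))
  next
    case False
    then have "v \<in> I" using v part_cases by blast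
    then have "nbrs G v \<subseteq> K" by (rule nbrs_I)
    with False show ?thesis by (intro unique_color_self) (auto simp: C_def)
  qed
  moreover have "C v \<in> {1..2}" for v by (simp add: C_def)
  ultimately show ?thesis unfolding cfcn_coloring_def by blast
qed

lemma coloring_if_double_star:
  assumes "card K = 2" and one: "\<forall>w\<in>I. deg G w = 1"
  shows "\<exists>C. cfcn_coloring G 2 C"
proof -
  obtain a b where K: "K = {a, b}" and ab: "a \<noteq> b" using assms(1) by (auto simp: card_2_iff)
  \<comment> \<open>This is the proper 2-coloring of the double star with centers \<open>a\<close>
    and \<open>b\<close>: leaves at \<open>b\<close> get the color of \<open>a\<close>, leaves at
    \<open>a\<close> that of \<open>b\<close>. Every vertex is thus alone in its color within its
    closed neighborhood.\<close>
  define C where "C v = (if v = a \<or> v \<in> I \<and> (v, b) \<in> parcs G then 1 else 2 :: int)" for v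
  have I: "nbrs G w = {a} \<or> nbrs G w = {b}" if w: "w \<in> I" for w
    using one w nbrs_I[OF w] unfolding deg_def K by (auto simp: card_1_singleton_iff)
  have not_I: "a \<notin> I" "b \<notin> I" using partition K by auto
  have "has_unique_color C (closed_nbhd G v)" if v: "v \<in> pverts G" for v
  proof -
    consider "v = a" | "v = b" | "v \<in> I" using v part_cases K by auto
    then show ?thesis
    proof cases
      case 1
      have "C y = 2" if "y \<in> nbrs G a" for y
      proof (cases "y \<in> I")
        case True
        then show ?thesis using I[OF True] that adj_sym[of a y] ab not_I by (auto simp: C_def nbrs_def)
      next
        case False
        then show ?thesis using that adj_irrefl by (auto simp: C_def nbrs_def)
      qed
      moreover have "C a = 1" by (simp add: C_def)
      ultimately show ?thesis unfolding 1 by (intro unique_color_self) simp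
    next
      case 2
      have "C y = 1" if "y \<in> nbrs G b" for y
        using that nbrs_verts[of b] part_cases[of y] adj_sym[of b y] K by (auto simp: C_def nbrs_def)
      moreover have "C b = 2" using ab not_I by (simp add: C_def)
      ultimately show ?thesis unfolding 2 by (intro unique_color_self) simp
    next
      case 3
      then have Cv: "C v = 1 \<longleftrightarrow> (v, b) \<in> parcs G" using not_I by (auto simp: C_def)
      have "C a = 1" "C b = 2" using ab not_I by (simp_all add: C_def)
      have "(v, b) \<in> parcs G \<longleftrightarrow> nbrs G v = {b}"
        using I[OF 3] ab by (metis mem_Collect_eq nbrs_def singletonD singletonI)
      with Cv have Cv': "C v = 1 \<longleftrightarrow> nbrs G v = {b}" by simp
      show ?thesis
      proof (rule unique_color_self)
        fix y assume y: "y \<in> nbrs G v"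
        from I[OF 3] show "C y \<noteq> C v"
        proof
          assume "nbrs G v = {a}"
          with y ab Cv' \<open>C a = 1\<close> show ?thesis by simp
        next
          assume "nbrs G v = {b}"
          with y Cv' \<open>C b = 2\<close> show ?thesis by simp
        qed
      qed
    qed
  qed
  moreover have "C v \<in> {1..2}" for v by (simp add: C_def)
  ultimately show ?thesis unfolding cfcn_coloring_def by blast
qed

section \<open>Structure forced by a 2-coloring\<close>

lemma structure_if_2_coloring:
  assumes C: "cfcn_coloring G 2 C" and no_univ: "\<nexists>v. universal G v"
  shows "(\<forall>v\<in>K. card (nbrs G v \<inter> I) = 1) \<or> card K = 2 \<and> (\<forall>w\<in>I. deg G w = 1)"
proof -
  have col: "C v = 1 \<or> C v = 2" if "v \<in> pverts G" for v
    using C that unfolding cfcn_coloring_def by force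
  have uniq: "\<exists>x\<in>closed_nbhd G v. \<forall>y\<in>closed_nbhd G v. C y = C x \<longrightarrow> y = x" if "v \<in> pverts G" for v
    using C that unfolding cfcn_coloring_def has_unique_color_iff by blast
  have nbhd_verts: "closed_nbhd G v \<subseteq> pverts G" if "v \<in> pverts G" for v
    using that nbrs_verts[of v] by (auto simp: closed_nbhd_eq)
  show ?thesis
  proof (cases "inj_on C K")
    case False
    then obtain x1 x2 where x: "x1 \<in> K" "x2 \<in> K" "x1 \<noteq> x2" "C x1 = C x2"
      by (auto simp: inj_on_def)
    define c where "c = C x1"
    have K_sub: "K \<subseteq> closed_nbhd G v" if "v \<in> K" for v
      using that adj_K by (auto simp: closed_nbhd_def)
    \<comment> \<open>The closed neighborhood of a clique vertex contains both \<open>x1\<close> and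
      \<open>x2\<close>, so \<open>c\<close> is not its unique color and the other color is.\<close>
    have other: "\<exists>x. {y \<in> closed_nbhd G v. C y \<noteq> c} = {x}" if v: "v \<in> K" for v
    proof -
      have vV: "v \<in> pverts G" using v part_cases by blast
      obtain x where x': "x \<in> closed_nbhd G v" "\<forall>y\<in>closed_nbhd G v. C y = C x \<longrightarrow> y = x"
        using uniq[OF vV] by blast
      have "x1 \<in> closed_nbhd G v" "x2 \<in> closed_nbhd G v" using K_sub[OF v] x by auto
      with x' x have "C x \<noteq> c" unfolding c_def by metis
      moreover have "y = x" if y: "y \<in> closed_nbhd G v" "C y \<noteq> c" for y
      proof -
        have "C y = C x"
        proof -
          have "x \<in> pverts G" "y \<in> pverts G" "x1 \<in> pverts G"
            using y(1) x'(1) nbhd_verts[OF vV] x(1) part_cases by auto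
          from this[THEN col] show ?thesis using y(2) \<open>C x \<noteq> c\<close> unfolding c_def by auto
        qed
        with x' y show ?thesis by blast
      qed
      ultimately have "{y \<in> closed_nbhd G v. C y \<noteq> c} = {x}" using x'(1) by blast
      then show ?thesis ..
    qed
    show ?thesis
    proof (cases "\<exists>v\<in>K. C v \<noteq> c")
      case True
      then obtain a where a: "a \<in> K" "C a \<noteq> c" by blast
      have only_a: "y = a" if v: "v \<in> K" and y: "y \<in> closed_nbhd G v" "C y \<noteq> c" for v y
      proof -
        obtain x where x: "{z \<in> closed_nbhd G v. C z \<noteq> c} = {x}" using other[OF v] by blast
        have "y \<in> {z \<in> closed_nbhd G v. C z \<noteq> c}" "a \<in> {z \<in> closed_nbhd G v. C z \<noteq> c}"
          using y a K_sub[OF v] by auto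
        then show ?thesis unfolding x by simp
      qed
      \<comment> \<open>\<open>w\<close> has color \<open>c\<close>, or it would coincide with
        \<open>a\<close>. Its closed neighborhood still contains the other color: either at the
        clique neighbor \<open>v\<close>, or because \<open>c\<close> occurs at both
        \<open>v\<close> and \<open>w\<close>. The vertex of that color lies in \<open>K\<close> and
        hence is \<open>a\<close>.\<close>
      have "(a, w) \<in> parcs G" if w: "w \<in> I" for w
      proof -
        have wV: "w \<in> pverts G" using w part_cases by blast
        obtain v where v: "v \<in> K" "(w, v) \<in> parcs G" using nbr_of_I w by blast
        have "w \<in> closed_nbhd G v" using v adj_sym by (simp add: closed_nbhd_def)
        then have Cw: "C w = c" using only_a[OF v(1)] a w partition by blast
        obtain y where "y \<in> closed_nbhd G w" "C y \<noteq> c"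
        proof (cases "C v = c")
          case False
          with v that show ?thesis by (auto simp: closed_nbhd_def)
        next
          case True
          obtain z where z: "z \<in> closed_nbhd G w" "\<forall>y\<in>closed_nbhd G w. C y = C z \<longrightarrow> y = z"
            using uniq[OF wV] by blast
          have "w \<in> closed_nbhd G w" "v \<in> closed_nbhd G w" "w \<noteq> v"
            using v w partition by (auto simp: closed_nbhd_def)
          with z Cw True have "C z \<noteq> c" by metis
          with z that show ?thesis by blast
        qed
        moreover from this have "y \<in> K" using Cw nbrs_I[OF w] by (auto simp: closed_nbhd_eq)
        ultimately have "y = a" using only_a[of y y] by (simp add: closed_nbhd_def)
        with \<open>y \<in> closed_nbhd G w\<close> w a partition show ?thesis
          using adj_sym by (auto simp: closed_nbhd_def)
      qed
      with a have "universal G a" unfolding universal_def using adj_K part_cases by blast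
      with no_univ show ?thesis by blast
    next
      case False
      \<comment> \<open>Here all of \<open>K\<close> has color \<open>c\<close>; a vertex of
        \<open>I\<close> of the same color would have a monochromatic closed neighborhood with at
        least two vertices.\<close>
      have CI: "C w \<noteq> c" if w: "w \<in> I" for w
      proof
        assume Cw: "C w = c"
        have wV: "w \<in> pverts G" using w part_cases by blast
        obtain v where v: "v \<in> K" "(w, v) \<in> parcs G" using nbr_of_I w by blast
        have all: "C y = c" if "y \<in> closed_nbhd G w" for y
          using that Cw False nbrs_I[OF w] by (auto simp: closed_nbhd_eq)
        have "w \<in> closed_nbhd G w" "v \<in> closed_nbhd G w" "w \<noteq> v"
          using v w partition by (auto simp: closed_nbhd_def)
        with uniq[OF wV] all show False by metis
      qed
      have "card (nbrs G v \<inter> I) = 1" if v: "v \<in> K" for v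
      proof -
        have "{y \<in> closed_nbhd G v. C y \<noteq> c} = nbrs G v \<inter> I"
          using v False CI nbrs_verts[of v] part_cases by (auto simp: closed_nbhd_eq)
        with other[OF v] show ?thesis by auto
      qed
      then show ?thesis by blast
    qed
  next
    case inj: True
    have "C ` K \<subseteq> {1, 2}" using col part_cases by auto
    then have "card K \<le> card {1, 2 :: int}" using inj by (intro card_inj_on_le[of C]) auto
    moreover have "card K > 1" using universal_if_card_K_le_1 no_univ by (meson not_le)
    ultimately have K2: "card K = 2" by simp
    then obtain a b where K: "K = {a, b}" and ab: "a \<noteq> b" by (auto simp: card_2_iff)
    have aV: "a \<in> pverts G" and bV: "b \<in> pverts G" using K part_cases by auto
    have Cab: "C a \<noteq> C b" using inj ab K by (auto simp: inj_on_def)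
    \<comment> \<open>As \<open>u\<close> is not universal, some \<open>y\<close> in
      \<open>I\<close> has \<open>v\<close> as its only neighbor, so \<open>y\<close> differs from
      \<open>v\<close> in color and agrees with \<open>u\<close>. If \<open>w\<close> had the color
      of \<open>v\<close>, both colors would occur twice around \<open>v\<close>.\<close>
    have diff: "C w \<noteq> C v" if v: "v \<in> K" "u \<in> K" "u \<noteq> v" and w: "w \<in> I" "(w, v) \<in> parcs G" for u v w
    proof
      assume Cw: "C w = C v"
      have K': "K = {u, v}" using K v by auto
      have verts: "u \<in> pverts G" "v \<in> pverts G" "w \<in> pverts G" using v w part_cases by auto
      obtain y where y: "y \<in> I" "(u, y) \<notin> parcs G"
        using no_univ verts(1) v part_cases adj_K unfolding universal_def by blast
      then have ny: "nbrs G y = {v}"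
        using nbrs_I[OF y(1)] no_isolated[of y] adj_sym K' part_cases by (auto simp: nbrs_def)
      have yV: "y \<in> pverts G" and yv: "y \<noteq> v" using y v part_cases partition by auto
      have Cy: "C y \<noteq> C v" using uniq[OF yV] yv by (auto simp: closed_nbhd_eq ny)
      have "C u \<noteq> C v" using inj v by (auto simp: inj_on_def)
      then have Cyu: "C y = C u" using Cy col[OF yV] col[OF verts(1)] col[OF verts(2)] by auto
      obtain z where z: "z \<in> closed_nbhd G v" "\<forall>x\<in>closed_nbhd G v. C x = C z \<longrightarrow> x = z"
        using uniq[OF verts(2)] by blast
      have "y \<in> closed_nbhd G v" "u \<in> closed_nbhd G v" "w \<in> closed_nbhd G v" "v \<in> closed_nbhd G v"
        using ny adj_sym adj_K v w by (auto simp: closed_nbhd_def nbrs_def)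
      moreover have "y \<noteq> u" "w \<noteq> v" using y v w partition by auto
      ultimately have "C z \<noteq> C u" "C z \<noteq> C v" using z Cyu Cw by metis+
      moreover have "z \<in> pverts G" using z nbhd_verts verts by blast
      ultimately show False using col[of z] col[OF verts(1)] col[OF verts(2)] \<open>C u \<noteq> C v\<close> by auto
    qed
    have "deg G w = 1" if w: "w \<in> I" for w
    proof -
      have wV: "w \<in> pverts G" using w part_cases by blast
      \<comment> \<open>Such a \<open>w\<close> would differ in color from both \<open>a\<close> and
        \<open>b\<close>, but these use up the two colors.\<close>
      have "\<not> ((w, a) \<in> parcs G \<and> (w, b) \<in> parcs G)"
        using diff[of a b w] diff[of b a w] w K ab Cab col[OF wV] col[OF aV] col[OF bV] by auto
      then have "nbrs G w = {a} \<or> nbrs G w = {b}"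
        using nbrs_I[OF w] no_isolated[OF wV] K by (auto simp: nbrs_def)
      then show ?thesis by (auto simp: deg_def)
    qed
    with K2 show ?thesis by blast
  qed
qed

section \<open>Colorability in terms of the degrees\<close>

lemma two_colorable_iff:
  "(\<exists>C. cfcn_coloring G 2 C) \<longleftrightarrow> max_deg G = card (pverts G) - 1 \<or>
     card {v \<in> pverts G. deg G v = max_deg G} = max_deg G \<or>
     (\<Sum>v\<in>pverts G. deg G v) = 2 * (card (pverts G) - 1)"
proof (cases "\<exists>v. universal G v")
  case True
  then show ?thesis using coloring_if_universal universal_iff_max_deg by auto
next
  case False
  have "(\<exists>C. cfcn_coloring G 2 C) \<longleftrightarrow>
      (\<forall>v\<in>K. card (nbrs G v \<inter> I) = 1) \<or> card K = 2 \<and> (\<forall>w\<in>I. deg G w = 1)"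
    using structure_if_2_coloring[OF _ False] coloring_if_one_nbr_in_I coloring_if_double_star by blast
  also have "\<dots> \<longleftrightarrow> card {v \<in> pverts G. deg G v = max_deg G} = max_deg G \<or>
     (\<Sum>v\<in>pverts G. deg G v) = 2 * (card (pverts G) - 1)"
    by (simp only: one_nbr_in_I_iff[OF False] double_star_iff[OF False])
  finally show ?thesis using False universal_iff_max_deg by simp
qed

end

text \<open>The vertex set of a connected graph is nonempty in the library.\<close>

lemma colorable_iff:
  assumes G: "pair_graph G" "Digraph_Component.connected (with_proj G)" "split_graph G"
  shows "(\<exists>C. cfcn_coloring G k C) \<longleftrightarrow> k \<ge> 3 \<or> k = 1 \<and> card (pverts G) = 1 \<or>
     k = 2 \<and> (max_deg G = card (pverts G) - 1 \<or>
       card {v \<in> pverts G. deg G v = max_deg G} = max_deg G \<or>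
       (\<Sum>v\<in>pverts G. deg G v) = 2 * (card (pverts G) - 1))"
proof -
  interpret pair_graph G by fact
  have sym: "symmetric (with_proj G)" using pair_sym_arcs .
  have ne: "pverts G \<noteq> {}" using G(2) by (simp add: connected_def strongly_connected_def)
  \<comment> \<open>Connectedness is strong connectedness of the symmetric closure, which leaves
    reachability unchanged because the graph is already symmetric.\<close>
  have reach: "u \<rightarrow>\<^sup>*\<^bsub>with_proj G\<^esub> v" if "u \<in> pverts G" "v \<in> pverts G" for u v
    using G(2) that reachable_mk_symmetric_eq[OF sym] by (simp add: connected_def strongly_connected_def)
  have no_color: "\<not> cfcn_coloring G k C" if "k < 1" for C
    using ne that by (auto simp: cfcn_coloring_def)
  show ?thesis
  proof (cases "card (pverts G) = 1")
    case True
    then obtain v where V: "pverts G = {v}" by (auto simp: card_1_singleton_iff)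
    have N: "nbrs G v = {}"
      using V in_arcsD2[of v] pair_no_loops[of "(v, v)"] by (fastforce simp: nbrs_def)
    have "cfcn_coloring G k (\<lambda>_. 1)" if "k \<ge> 1"
      using that V N by (auto simp: cfcn_coloring_def has_unique_color_iff closed_nbhd_eq)
    \<comment> \<open>This covers \<open>k = 2\<close> for a single vertex: the maximum degree
      equals \<open>card (pverts G) - 1\<close>.\<close>
    moreover have "max_deg G = 0" by (simp add: max_deg_def V deg_def N)
    ultimately show ?thesis using no_color[of] True by force
  next
    case False
    have no_isolated: "nbrs G v \<noteq> {}" if v: "v \<in> pverts G" for v
    proof -
      have "pverts G \<noteq> {v}" using False by auto
      then obtain u where u: "u \<in> pverts G" "u \<noteq> v" using v by blast
      \<comment> \<open>The first arc of a walk from \<open>v\<close> to \<open>u\<close> leads to a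
        neighbor of \<open>v\<close>.\<close>
      from reach[OF v u(1)] u(2) show ?thesis
        by (cases rule: converse_reachable_cases) (auto simp: nbrs_def)
    qed
    obtain K I where KI: "K \<union> I = pverts G" "K \<inter> I = {}" "clique G K" "independent_set G I"
      using G(3) by (auto simp: split_graph_def)
    interpret partitioned_split_graph G K I
      by unfold_locales (use KI ne no_isolated in auto)
    have no_1: "\<not> cfcn_coloring G 1 C" for C
    proof
      assume C: "cfcn_coloring G 1 C"
      obtain v where v: "v \<in> pverts G" using ne by blast
      then obtain u where u: "u \<in> nbrs G v" using no_isolated by blast
      have "C x = 1" if "x \<in> closed_nbhd G v" for x
        using C that v nbrs_verts[of v] by (auto simp: cfcn_coloring_def closed_nbhd_eq)
      moreover have "u \<noteq> v" using u nbrs_verts by blast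
      moreover have "u \<in> closed_nbhd G v" "v \<in> closed_nbhd G v" using u by (auto simp: closed_nbhd_eq)
      moreover have "has_unique_color C (closed_nbhd G v)" using C v by (simp add: cfcn_coloring_def)
      ultimately show False unfolding has_unique_color_iff by metis
    qed
    consider "k < 1" | "k = 1" | "k = 2" | "k \<ge> 3" by linarith
    then show ?thesis
    proof cases
      case 1
      with no_color show ?thesis by simp
    next
      case 2
      with no_1 False show ?thesis by simp
    next
      case 3
      with two_colorable_iff show ?thesis by simp
    next
      case 4
      with coloring_if_3 show ?thesis by simp
    qed
  qed
qed


section \<open>Programs\<close>

text \<open>\<open>T\<close> is the time already elapsed, so that sequential composition becomes composition of transformers.\<close>

definition wp :: "com \<Rightarrow> (nat \<Rightarrow> state \<Rightarrow> bool) \<Rightarrow> nat \<Rightarrow> state \<Rightarrow> bool" where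
  "wp c Q T s \<longleftrightarrow> (\<exists>t s'. exec c s t s' \<and> Q (T + t) s')"

lemma wp_Const: "wp (Const r n) Q T (R, M) \<longleftrightarrow> Q (Suc T) (R(r := n), M)"
  and wp_Add: "wp (Add r a b) Q T (R, M) \<longleftrightarrow> Q (Suc T) (R(r := R a + R b), M)"
  and wp_Sub: "wp (Sub r a b) Q T (R, M) \<longleftrightarrow> Q (Suc T) (R(r := R a - R b), M)"
  and wp_Load: "wp (Load r a) Q T (R, M) \<longleftrightarrow> Q (Suc T) (R(r := M (R a)), M)"
  unfolding wp_def by (auto elim!: exec_elims intro!: exI exec.intros[unfolded One_nat_def])

lemma wp_Seq: "wp (Seq c1 c2) Q T s \<longleftrightarrow> wp c1 (wp c2 Q) T s"
  unfolding wp_def by (fastforce elim: exec_elims intro: exec.Seq simp: add.assoc)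

lemma wp_Cond:
  "wp (Cond r c1 c2) Q T (R, M) \<longleftrightarrow> (if R r \<noteq> 0 then wp c1 Q (Suc T) (R, M) else wp c2 Q (Suc T) (R, M))"
proof -
  have "exec (Cond r c1 c2) (R, M) t s \<longleftrightarrow>
      (\<exists>u. t = Suc u \<and> exec (if R r \<noteq> 0 then c1 else c2) (R, M) u s)" for t s
    using exec.CondTrue[of R r c1 M _ s c2] exec.CondFalse[of R r c2 M _ s c1]
    by (auto elim!: exec_elims(7) split: if_splits)
  then show ?thesis by (simp add: wp_def del: split_paired_Ex) (metis add_Suc_right)
qed

lemmas wp_simps = wp_Const wp_Add wp_Sub wp_Load wp_Seq wp_Cond

lemma wp_mono: "wp c Q T s \<Longrightarrow> (\<And>T s. Q T s \<Longrightarrow> Q' T s) \<Longrightarrow> wp c Q' T s"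
  unfolding wp_def by blast

lemma wp_While_False: "R r = 0 \<Longrightarrow> Q (Suc T) (R, M) \<Longrightarrow> wp (While r c) Q T (R, M)"
  unfolding wp_def using exec.WhileFalse[of R r c M] by fastforce

lemma wp_While_True:
  assumes "R r \<noteq> 0" "wp c (wp (While r c) Q) (Suc T) (R, M)"
  shows "wp (While r c) Q T (R, M)"
proof -
  obtain t1 s2 t2 s3 where "exec c (R, M) t1 s2" "exec (While r c) s2 t2 s3" "Q (Suc T + t1 + t2) s3"
    using assms(2) unfolding wp_def by blast
  with assms(1) show ?thesis unfolding wp_def
    by (intro exI[of _ "1 + t1 + t2"] exI[of _ s3]) (auto intro: exec.WhileTrue[simplified] simp: add.assoc)
qed

text \<open>The number \<open>n\<close> of iterations is known beforehand, so an invariant indexed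
  by the iteration replaces a termination measure; it also records the elapsed time.\<close>

lemma wp_While:
  fixes Inv :: "nat \<Rightarrow> nat \<Rightarrow> state \<Rightarrow> bool"
  assumes init: "Inv 0 T (R, M)"
    and step: "\<And>i T R M. i < n \<Longrightarrow> Inv i T (R, M) \<Longrightarrow> R r \<noteq> 0 \<and> wp c (Inv (Suc i)) (Suc T) (R, M)"
    and exit: "\<And>T R M. Inv n T (R, M) \<Longrightarrow> R r = 0 \<and> Q (Suc T) (R, M)"
  shows "wp (While r c) Q T (R, M)"
proof -
  have "\<forall>T s. Inv i T s \<longrightarrow> wp (While r c) Q T s" if "i \<le> n" for i
    using that
  proof (induction rule: inc_induct)
    case base
    then show ?case using exit by (auto intro: wp_While_False)
  next
    case (step i)
    show ?case
    proof (clarify, rule wp_While_True)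
      fix T R M assume "Inv i T (R, M)"
      with assms(2) step.hyps have *: "R r \<noteq> 0" "wp c (Inv (Suc i)) (Suc T) (R, M)" by blast+
      show "R r \<noteq> 0" by fact
      show "wp c (wp (While r c) Q) (Suc T) (R, M)"
        by (rule wp_mono[OF *(2)]) (use step.IH in blast)
    qed
  qed
  with init show ?thesis by blast
qed

section \<open>The decision program\<close>

notation Seq (infixr \<open>;;\<close> 60)

text \<open>
  Register 1 holds the number of vertices, 2 the constant 1, 3 the current address,
  8 the maximum degree, 9 the number of vertices of that degree, 10 the sum of the degrees;
  register 15 is never written and stays 0.
\<close>

definition read_size :: com where
  "read_size = Const 2 1 ;; Load 4 3 ;; While 4 (Add 3 3 2 ;; Load 4 3) ;; Add 1 3 15 ;; Add 3 3 2"

text \<open>Matrix entries are 0 or 1, so the sum of a row is a degree. Adding register 15 copies a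
  register.\<close>

definition read_row :: com where
  "read_row = Const 7 0 ;; Add 6 1 15 ;; While 6 (Load 4 3 ;; Add 7 7 4 ;; Add 3 3 2 ;; Sub 6 6 2)"

text \<open>A truncated difference is nonzero exactly if its first operand is larger. A new maximum
  restarts the count at 1; for a smaller degree \<open>Const 11 0\<close> serves as an idle
  step.\<close>

definition record_degree :: com where
  "record_degree = Add 10 10 7 ;; Sub 11 7 8 ;; Cond 11 (Add 8 7 15 ;; Const 9 1)
     (Sub 11 8 7 ;; Cond 11 (Const 11 0) (Add 9 9 2))"

definition read_matrix :: com where
  "read_matrix = Add 5 1 15 ;; While 5 (read_row ;; record_degree ;; Sub 5 5 2)"

text \<open>The two truncated differences add up to the absolute difference, which is nonzero if the
  registers differ; hence the swapped branches.\<close>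

definition if_equal :: "nat \<Rightarrow> nat \<Rightarrow> com \<Rightarrow> com \<Rightarrow> com" where
  "if_equal a b c1 c2 = Sub 12 a b ;; Sub 13 b a ;; Add 12 12 13 ;; Cond 12 c2 c1"

definition two_colors :: com where
  "two_colors = Sub 11 1 2 ;; if_equal 8 11 (Const 0 1) (if_equal 9 8 (Const 0 1)
     (Add 11 11 11 ;; if_equal 10 11 (Const 0 1) (Const 0 0)))"

text \<open>Register 0 still holds the input length, so register 12 receives the number of binary
  digits of \<open>k\<close>, and \<open>k\<close> itself is never computed. Once the sign bit has
  excluded negative values, no digit means 0, one digit 1, two digits 2 or 3 as told by the low bit,
  and more digits at least 4.\<close>

definition decide :: com where
  "decide = Load 4 3 ;; Add 3 3 2 ;; Sub 12 0 3 ;; Cond 4 (Const 0 0) (Cond 12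
     (Sub 12 12 2 ;; Cond 12
       (Sub 12 12 2 ;; Cond 12 (Const 0 1) (Load 4 3 ;; Cond 4 (Const 0 1) two_colors))
       (if_equal 1 2 (Const 0 1) (Const 0 0)))
     (Const 0 0))"

definition cfcn_program :: com where
  "cfcn_program = read_size ;; read_matrix ;; decide"

section \<open>Correctness and running time of the program parts\<close>

lemma wp_read_size:
  assumes "\<And>i. i < n \<Longrightarrow> M i \<noteq> 0" "M n = 0" "R 3 = 0" "R 15 = 0"
  shows "wp read_size (\<lambda>T' (R', M'). M' = M \<and> T' = T + 3 * n + 5 \<and> R' 1 = n \<and> R' 2 = 1 \<and> R' 3 = n + 1 \<and>
      (\<forall>r. r \<notin> {1, 2, 3, 4} \<longrightarrow> R' r = R r)) T (R, M)"
  unfolding read_size_def wp_simps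
  by (rule wp_While[where n = n and Inv = "\<lambda>i T' (R', M'). M' = M \<and> T' = T + 3 * i + 2 \<and> R' 2 = 1 \<and> R' 3 = i \<and>
      R' 4 = M i \<and> (\<forall>r. r \<notin> {1, 2, 3, 4} \<longrightarrow> R' r = R r)"]) (use assms in \<open>auto simp: wp_simps\<close>)

lemma wp_read_row:
  assumes "R 1 = n" "R 2 = 1" "R 15 = 0"
  shows "wp read_row (\<lambda>T' (R', M'). M' = M \<and> T' = T + 5 * n + 3 \<and> R' 7 = (\<Sum>j<n. M (R 3 + j)) \<and>
      R' 3 = R 3 + n \<and> (\<forall>r. r \<notin> {3, 4, 6, 7} \<longrightarrow> R' r = R r)) T (R, M)"
  unfolding read_row_def wp_simps
  by (rule wp_While[where n = n and Inv = "\<lambda>i T' (R', M'). M' = M \<and> T' = T + 5 * i + 2 \<and> R' 7 = (\<Sum>j<i. M (R 3 + j)) \<and>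
      R' 3 = R 3 + i \<and> R' 6 = n - i \<and> (\<forall>r. r \<notin> {3, 4, 6, 7} \<longrightarrow> R' r = R r)"]) (use assms in \<open>auto simp: wp_simps\<close>)

text \<open>The inserted 0 gives the empty prefix the value that register 8 holds initially.\<close>

definition max_upto :: "(nat \<Rightarrow> nat) \<Rightarrow> nat \<Rightarrow> nat" where
  "max_upto f i = Max (insert 0 (f ` {..<i}))"

lemma max_upto_0 [simp]: "max_upto f 0 = 0"
  by (simp add: max_upto_def)

lemma max_upto_Suc: "max_upto f (Suc i) = max (f i) (max_upto f i)"
proof -
  have "insert 0 (f ` {..<Suc i}) = insert (f i) (insert 0 (f ` {..<i}))"
    by (auto simp: lessThan_Suc)
  then show ?thesis by (simp add: max_upto_def)
qed

lemma max_upto_ge: "j < i \<Longrightarrow> f j \<le> max_upto f i"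
  by (simp add: max_upto_def)

definition count_max :: "(nat \<Rightarrow> nat) \<Rightarrow> nat \<Rightarrow> nat" where
  "count_max f i = card {j. j < i \<and> f j = max_upto f i}"

lemma count_max_0 [simp]: "count_max f 0 = 0"
  by (simp add: count_max_def)

text \<open>The recurrence behind \<open>record_degree\<close>: earlier indices keep their status
  unless the new value exceeds all of them, and then none attains the maximum any more.\<close>

lemma count_max_Suc:
  "count_max f (Suc i) = (if max_upto f i < f i then 1
     else if f i = max_upto f i then Suc (count_max f i) else count_max f i)"
proof -
  consider "max_upto f i < f i" | "f i = max_upto f i" | "f i < max_upto f i"
    by linarith
  then show ?thesis
  proof cases
    case 1
    then have "{j. j < Suc i \<and> f j = max_upto f (Suc i)} = {i}"
      using leD[OF max_upto_ge[of _ i f]] by (fastforce simp: max_upto_Suc less_Suc_eq)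
    with 1 show ?thesis by (simp add: count_max_def)
  next
    case 2
    then have "{j. j < Suc i \<and> f j = max_upto f (Suc i)} = insert i {j. j < i \<and> f j = max_upto f i}"
      by (auto simp: max_upto_Suc)
    with 2 show ?thesis by (simp add: count_max_def)
  next
    case 3
    then have "{j. j < Suc i \<and> f j = max_upto f (Suc i)} = {j. j < i \<and> f j = max_upto f i}"
      by (auto simp: max_upto_Suc less_Suc_eq)
    with 3 show ?thesis by (simp add: count_max_def)
  qed
qed

lemma wp_record_degree:
  assumes "R 2 = 1" "R 15 = 0" "R 7 = f i" "R 8 = max_upto f i" "R 9 = count_max f i" "R 10 = (\<Sum>j<i. f j)"
  shows "wp record_degree (\<lambda>T' (R', M'). M' = M \<and> T' \<le> T + 6 \<and>
      R' 8 = max_upto f (Suc i) \<and> R' 9 = count_max f (Suc i) \<and> R' 10 = (\<Sum>j<Suc i. f j) \<and>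
      (\<forall>r. r \<notin> {8, 9, 10, 11} \<longrightarrow> R' r = R r)) T (R, M)"
  using assms by (auto simp: record_degree_def wp_simps max_upto_Suc count_max_Suc)

lemma wp_read_matrix:
  assumes "R 1 = n" "R 2 = 1" "R 15 = 0" "R 8 = 0" "R 9 = 0" "R 10 = 0"
    and f: "\<And>i. f i = (\<Sum>j<n. M (R 3 + i * n + j))"
  shows "wp read_matrix (\<lambda>T' (R', M'). M' = M \<and> T' \<le> T + 2 + n * (5 * n + 11) \<and>
      R' 8 = max_upto f n \<and> R' 9 = count_max f n \<and> R' 10 = (\<Sum>j<n. f j) \<and> R' 3 = R 3 + n * n \<and>
      R' 0 = R 0 \<and> R' 1 = n \<and> R' 2 = 1) T (R, M)"
  unfolding read_matrix_def wp_simps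
\<comment> \<open>One iteration costs 1 for the test, \<open>5 * n + 3\<close> for the row, at most
  6 for recording its sum and 1 for the decrement.\<close>
proof (rule wp_While[where n = n and Inv = "\<lambda>i T' (R', M'). M' = M \<and> T' \<le> T + 1 + i * (5 * n + 11) \<and>
      R' 8 = max_upto f i \<and> R' 9 = count_max f i \<and> R' 10 = (\<Sum>j<i. f j) \<and> R' 3 = R 3 + i * n \<and>
      R' 5 = n - i \<and> R' 0 = R 0 \<and> R' 1 = n \<and> R' 2 = 1 \<and> R' 15 = 0"], goal_cases)
  case (2 i U R1 M1)
  then show ?case
    apply (intro conjI)
     apply simp
    unfolding wp_Seq
    apply (rule wp_mono[OF wp_read_row[where n = n]])
       apply simp_all
    apply (clarsimp)
    apply (rule wp_mono[OF wp_record_degree[where f = f and i = i]])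
          apply (simp_all add: f wp_simps)
    apply (clarsimp simp: wp_simps)
    done
qed (use assms in auto)

text \<open>With \<open>p\<close> the address of the sign bit and \<open>b\<close> binary digits,
  the input has length \<open>p + 1 + b\<close>. So \<open>p + 2\<close> and \<open>p + 3\<close>
  stand for one and two digits, and the last comparison also rejects \<open>b = 0\<close>.\<close>

lemma wp_decide:
  assumes "R 2 = 1" "R 3 = p"
  shows "wp decide (\<lambda>T' (R', M'). T' \<le> T + 30 \<and> R' 0 = (if
      M p = 0 \<and> (if R 0 = p + 2 then R 1 = 1 else if R 0 = p + 3 then M (p + 1) \<noteq> 0 \<or>
        R 8 = R 1 - 1 \<or> R 9 = R 8 \<or> R 10 = 2 * (R 1 - 1) else R 0 > p + 3) then 1 else 0)) T (R, M)"
  using assms by (auto simp: decide_def two_colors_def if_equal_def wp_simps)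


section \<open>Correctness on encoded instances\<close>

lemma nth_concat_map:
  assumes "\<And>x. x \<in> set xs \<Longrightarrow> length (f x) = m" "i < length xs" "j < m"
  shows "concat (map f xs) ! (i * m + j) = f (xs ! i) ! j"
  using assms(1,2)
proof (induction xs arbitrary: i)
  case (Cons x xs)
  then show ?case using assms(3) by (cases i) (simp_all add: nth_append)
qed simp

lemma length_adjacency_bits: "length (adjacency_bits vs G) = length vs * length vs"
  by (simp add: adjacency_bits_def length_concat o_def sum_list_triv)

lemma nth_adjacency_bits:
  "i < length vs \<Longrightarrow> j < length vs \<Longrightarrow>
    adjacency_bits vs G ! (i * length vs + j) \<longleftrightarrow> (vs ! i, vs ! j) \<in> parcs G"
  unfolding adjacency_bits_def by (subst nth_concat_map) auto

lemma length_nat_bits_eq_0_iff: "length (nat_bits m) = 0 \<longleftrightarrow> m = 0"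
  by (subst nat_bits.simps) simp

lemma length_nat_bits_eq_Suc_iff:
  "length (nat_bits m) = Suc j \<longleftrightarrow> m \<noteq> 0 \<and> length (nat_bits (m div 2)) = j"
  by (subst nat_bits.simps) simp

lemma length_nat_bits_eq_1_iff: "length (nat_bits m) = 1 \<longleftrightarrow> m = 1"
  unfolding One_nat_def length_nat_bits_eq_Suc_iff length_nat_bits_eq_0_iff by auto

lemma length_nat_bits_eq_2_iff: "length (nat_bits m) = 2 \<longleftrightarrow> m = 2 \<or> m = 3"
proof -
  have "length (nat_bits m) = 2 \<longleftrightarrow> m \<noteq> 0 \<and> m div 2 = 1"
    using length_nat_bits_eq_Suc_iff[of m 1] length_nat_bits_eq_1_iff[of "m div 2"]
    by (simp only: Suc_1)
  also have "\<dots> \<longleftrightarrow> m = 2 \<or> m = 3" by presburger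
  finally show ?thesis .
qed

lemma hd_nat_bits: "m \<noteq> 0 \<Longrightarrow> nat_bits m ! 0 \<longleftrightarrow> odd m"
  by (subst nat_bits.simps) simp

section \<open>Degree data along the vertex enumeration\<close>

lemma deg_nth:
  assumes "set vs = pverts G" "distinct vs" "pair_graph G"
  shows "deg G u = (\<Sum>j<length vs. if (u, vs ! j) \<in> parcs G then 1 else 0)"
proof -
  interpret pair_graph G by fact
  have "bij_betw (nth vs) {..<length vs} (set vs)"
    by (rule bij_betw_nth) (use assms(2) in auto)
  then have "(\<Sum>j<length vs. if (u, vs ! j) \<in> parcs G then 1 else 0) =
      (\<Sum>v\<in>pverts G. if (u, v) \<in> parcs G then 1 else 0)"
    unfolding assms(1) by (rule sum.reindex_bij_betw)
  also have "\<dots> = card {v \<in> pverts G. (u, v) \<in> parcs G}"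
    using pair_finite_verts by (simp flip: sum.inter_filter)
  also have "{v \<in> pverts G. (u, v) \<in> parcs G} = nbrs G u"
    using in_arcsD2 by (auto simp: nbrs_def)
  finally show ?thesis by (simp add: deg_def)
qed

lemma max_upto_nth:
  assumes "set vs = pverts G" "pverts G \<noteq> {}" "\<And>i. i < length vs \<Longrightarrow> f i = deg G (vs ! i)"
  shows "max_upto f (length vs) = max_deg G"
proof -
  have "f ` {..<length vs} = deg G ` (nth vs ` {..<length vs})"
    using assms(3) by (auto simp: image_image)
  also have "nth vs ` {..<length vs} = pverts G"
    using assms(1) by (auto simp: set_conv_nth)
  finally have "f ` {..<length vs} = deg G ` pverts G" .
  moreover have "finite (pverts G)" by (simp flip: assms(1))
  \<comment> \<open>The 0 in \<open>max_upto\<close> does not affect the maximum of a nonempty set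
    of naturals.\<close>
  ultimately show ?thesis using assms(2) by (simp add: max_upto_def max_deg_def)
qed

lemma count_max_nth:
  assumes "set vs = pverts G" "distinct vs" "pverts G \<noteq> {}" "\<And>i. i < length vs \<Longrightarrow> f i = deg G (vs ! i)"
  shows "count_max f (length vs) = card {v \<in> pverts G. deg G v = max_deg G}"
proof -
  have "{v \<in> pverts G. deg G v = max_deg G} = nth vs ` {j. j < length vs \<and> deg G (vs ! j) = max_deg G}"
    unfolding assms(1)[symmetric] by (auto simp: in_set_conv_nth)
  also have "{j. j < length vs \<and> deg G (vs ! j) = max_deg G} = {j. j < length vs \<and> f j = max_deg G}"
    using assms(4) by auto
  finally have "{v \<in> pverts G. deg G v = max_deg G} = nth vs ` {j. j < length vs \<and> f j = max_deg G}" .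
  moreover have "inj_on (nth vs) {j. j < length vs \<and> f j = max_deg G}"
    using assms(2) by (auto simp: inj_on_def nth_eq_iff_index_eq)
  ultimately show ?thesis
    by (simp add: count_max_def max_upto_nth[OF assms(1,3,4)] card_image)
qed

lemma sum_nth:
  assumes "set vs = pverts G" "distinct vs" "\<And>i. i < length vs \<Longrightarrow> f i = deg G (vs ! i)"
  shows "(\<Sum>i<length vs. f i) = (\<Sum>v\<in>pverts G. deg G v)"
proof -
  have "bij_betw (nth vs) {..<length vs} (pverts G)"
    by (rule bij_betw_nth) (use assms in auto)
  then have "(\<Sum>i<length vs. deg G (vs ! i)) = (\<Sum>v\<in>pverts G. deg G v)"
    by (rule sum.reindex_bij_betw)
  with assms(3) show ?thesis by simp
qed

text \<open>The three parts take \<open>3 * n + 5\<close>, at most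
  \<open>2 + n * (5 * n + 11)\<close> and at most 30 steps. Memory is described only by its layout;
  graphs enter in the next lemma.\<close>

lemma wp_cfcn_program:
  assumes "\<And>i. i < n \<Longrightarrow> M i \<noteq> 0" "M n = 0"
    and f: "\<And>i. f i = (\<Sum>j<n. M (n + 1 + i * n + j))" and p: "p = n + 1 + n * n"
  shows "wp cfcn_program (\<lambda>T (R, M'). T \<le> 5 * n * n + 14 * n + 37 \<and> R 0 = (if
      M p = 0 \<and> (if L = p + 2 then n = 1 else if L = p + 3 then M (p + 1) \<noteq> 0 \<or>
        max_upto f n = n - 1 \<or> count_max f n = max_upto f n \<or> (\<Sum>j<n. f j) = 2 * (n - 1)
        else L > p + 3) then 1 else 0)) 0 ((\<lambda>_. 0)(0 := L), M)"
  unfolding cfcn_program_def wp_Seq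
proof (rule wp_mono[OF wp_read_size[where n = n]], goal_cases)
  case (5 T s)
  obtain R M' where s: "s = (R, M')" by fastforce
  with 5 have R: "M' = M" "T = 3 * n + 5" "R 1 = n" "R 2 = 1" "R 3 = n + 1"
    "R 0 = L" "R 15 = 0" "R 8 = 0" "R 9 = 0" "R 10 = 0"
    by auto
  show ?case unfolding s
  proof (rule wp_mono[OF wp_read_matrix[where n = n and f = f]], goal_cases)
    case (8 T1 s1)
    obtain R1 M1 where s1: "s1 = (R1, M1)" by fastforce
    with 8 R p have R1: "M1 = M" "T1 \<le> 3 * n + 7 + n * (5 * n + 11)" "R1 1 = n" "R1 2 = 1" "R1 3 = p"
      "R1 0 = L" "R1 8 = max_upto f n" "R1 9 = count_max f n" "R1 10 = (\<Sum>j<n. f j)"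
      by auto
    show ?case unfolding s1
    proof (rule wp_mono[OF wp_decide[OF R1(4,5)]], goal_cases)
      case (1 T2 s2)
      then show ?case using R1 by (cases s2) (simp add: algebra_simps)
    qed
  qed (use R f in auto)
qed (use assms in auto)

lemma cfcn_program_decides:
  assumes "(vs, G, k) \<in> connected_split_instances"
  shows "wp cfcn_program (\<lambda>T (R, M). T \<le> 40 * length (encode (vs, G, k)) \<and>
      R 0 = (if \<exists>C. cfcn_coloring G k C then 1 else 0)) 0 (input_state (encode (vs, G, k)))"
proof -
  from assms have G: "pair_graph G" "Digraph_Component.connected (with_proj G)" "split_graph G"
    and vs: "distinct vs" "set vs = pverts G"
    by (auto simp: connected_split_instances_def)
  interpret pair_graph G by fact
  have ne: "pverts G \<noteq> {}" using G(2) by (simp add: connected_def strongly_connected_def)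
  define n where "n = length vs"
  define b where "b = length (nat_bits (nat \<bar>k\<bar>))"
  define w where "w = encode (vs, G, k)"
  define M :: "nat \<Rightarrow> nat" where "M i = (if i < length w \<and> w ! i then 1 else 0)" for i
  \<comment> \<open>The sign bit follows \<open>n + 1\<close> cells for the terminated unary size
    and \<open>n * n\<close> matrix entries.\<close>
  define p where "p = n + 1 + n * n"
  have n: "card (pverts G) = n" using vs distinct_card n_def by metis
  have w: "w = replicate n True @ False # adjacency_bits vs G @ (k < 0) # nat_bits (nat \<bar>k\<bar>)"
    by (simp add: w_def n_def int_bits_def)
  have L: "length w = p + 1 + b"
    by (simp add: w p_def b_def length_adjacency_bits n_def)
  have unary: "M i \<noteq> 0" if "i < n" for i
    using that L by (simp add: M_def p_def) (simp add: w nth_append)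
  have "M n = 0" by (simp add: M_def w nth_append)
  have matrix: "M (n + 1 + i * n + j) = (if (vs ! i, vs ! j) \<in> parcs G then 1 else 0)"
    if "i < n" "j < n" for i j
  proof -
    have "i * n + j < Suc i * n" using that by simp
    also have "\<dots> \<le> n * n" using that by (intro mult_right_mono) auto
    finally have lt: "i * n + j < n * n" .
    then have "w ! (n + 1 + i * n + j) = adjacency_bits vs G ! (i * n + j)"
      by (simp add: w nth_append length_adjacency_bits n_def)
    with that lt L show ?thesis
      by (simp add: M_def p_def nth_adjacency_bits n_def)
  qed
  have tail: "w ! (p + i) = ((k < 0) # nat_bits (nat \<bar>k\<bar>)) ! i" for i
    by (simp add: w p_def nth_append length_adjacency_bits n_def)
  have sgn: "M p = 0 \<longleftrightarrow> k \<ge> 0" using tail[of 0] L by (auto simp: M_def)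
  \<comment> \<open>The digits start with the least significant one, so this cell separates 3 from
    2.\<close>
  have low_bit: "M (p + 1) \<noteq> 0 \<longleftrightarrow> odd (nat \<bar>k\<bar>)" if "b = 2"
    using tail[of 1] L that length_nat_bits_eq_0_iff[of "nat \<bar>k\<bar>"] hd_nat_bits[of "nat \<bar>k\<bar>"]
    by (auto simp: M_def b_def)
  define f where "f i = (\<Sum>j<n. M (n + 1 + i * n + j))" for i
  have f: "f i = deg G (vs ! i)" if "i < length vs" for i
    unfolding f_def deg_nth[OF vs(2,1) G(1)] n_def[symmetric]
    by (intro sum.cong refl matrix) (use that n_def in auto)
  have degs: "max_upto f n = max_deg G" "count_max f n = card {v \<in> pverts G. deg G v = max_deg G}"
    "(\<Sum>j<n. f j) = (\<Sum>v\<in>pverts G. deg G v)"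
    unfolding n_def using max_upto_nth[OF vs(2) ne f] count_max_nth[OF vs(2,1) ne f] sum_nth[OF vs(2,1) f] by auto
  have b: "b = 0 \<longleftrightarrow> k = 0" "b = 1 \<longleftrightarrow> nat \<bar>k\<bar> = 1" "b = 2 \<longleftrightarrow> nat \<bar>k\<bar> = 2 \<or> nat \<bar>k\<bar> = 3"
    unfolding b_def length_nat_bits_eq_0_iff length_nat_bits_eq_1_iff length_nat_bits_eq_2_iff by auto
  have answer: "(M p = 0 \<and> (if length w = p + 2 then n = 1 else if length w = p + 3 then M (p + 1) \<noteq> 0 \<or>
      max_upto f n = n - 1 \<or> count_max f n = max_upto f n \<or> (\<Sum>j<n. f j) = 2 * (n - 1)
      else length w > p + 3)) \<longleftrightarrow> (\<exists>C. cfcn_coloring G k C)"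
  proof -
    consider "k < 0" | "k = 0" | "k = 1" | "k = 2" | "k = 3" | "k > 3" by linarith
    then show ?thesis
    proof cases
      case 6
      then have "b > 2" using b by auto
      with 6 sgn L show ?thesis by (simp add: colorable_iff[OF G])
    qed (use sgn L b low_bit in \<open>simp_all add: colorable_iff[OF G] n degs\<close>)
  qed
  \<comment> \<open>The matrix alone occupies \<open>n * n\<close> bits, so the quadratic bound in
    \<open>n\<close> is linear in the input length.\<close>
  have time: "5 * n * n + 14 * n + 37 \<le> 40 * length w"
    by (simp add: L p_def)
  have "input_state w = ((\<lambda>_. 0)(0 := length w), M)"
    by (simp add: input_state_def M_def fun_eq_iff)
  with wp_cfcn_program[OF unary \<open>M n = 0\<close> f_def p_def, of "length w"] time
  show ?thesis unfolding answer w_def[symmetric] by (auto elim!: wp_mono)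
qed

theorem theorem3:
  shows "poly_time_decidable_on encode connected_split_instances
           (\<lambda>(vs, G, k). \<exists>C. cfcn_coloring G k C)"
  unfolding poly_time_decidable_on_def
proof (intro exI[of _ cfcn_program] exI[of _ "[:0, 40:]"] ballI)
  fix x :: "nat list \<times> nat pair_pre_digraph \<times> int"
  assume "x \<in> connected_split_instances"
  moreover obtain vs G k where "x = (vs, G, k)" by (cases x)
  ultimately show "\<exists>t R M. exec cfcn_program (input_state (encode x)) t (R, M) \<and>
      t \<le> poly [:0, 40:] (length (encode x)) \<and>
      R 0 = (if case x of (vs, G, k) \<Rightarrow> \<exists>C. cfcn_coloring G k C then 1 else 0)"
    using cfcn_program_decides[of vs G k] by (auto simp: wp_def mult.commute simp del: encode.simps)
qed

end
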